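(* The following deterministic online algorithm with advice for \textsc{MBM} is $\frac35$-competitive and uses $m$ advice bits. The oracle runs $\textsc{Ranking}(\sigma)$ on the input with $\sigma$ the identity ranking ($\sigma(b)=b$), obtaining a matching $M_G$, and sets $c(b)=1$ if $b\in B$ is not matched in $M_G$ and $c(b)=2$ otherwise; the function $c$ is given to the algorithm as $m$ advice bits. The algorithm then returns $\textsc{Ranking}(\sigma_c)$.
   Context: Online maximum bipartite matching (\textsc{MBM}): the input is a bipartite graph $G=(A,B,E)$ with $A=[n]$, $B=[m]$, $m=\Theta(n)$; the $A$-vertices, together with their incident edges, arrive one at a time in an adversarially chosen order, and upon arrival of $a\in A$ the algorithm must irrevocably match $a$ to a currently unmatched neighbour or leave it unmatched. In the advice (tape) model, an all-powerful oracle knowing the whole input (including the arrival order) writes an advice string beforehand that the algorithm may read. A deterministic algorithm is $\rho$-competitive if on every input its output matching $M$ satisfies $|M|\ge\rho|M^*|$, $M^*$ a maximum matching. $\textsc{Ranking}(\sigma)$, for a permutation $\sigma$ of $B$, matches each arriving $A$-vertex (in the input's arrival order) to its unmatched neighbour $b$ of minimum $\sigma(b)$, leaving it unmatched if none exists. For $c:B\to\{1,2\}$, $\sigma_c$ is the unique permutation of $B$ with $\sigma_c(b_1)<\sigma_c(b_2)$ iff $c(b_1)<c(b_2)$, or $c(b_1)=c(b_2)$ and $b_1<b_2$. *)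

theory Defs
  imports Complex_Main "HOL-Combinatorics.Permutations"
begin

record mbm_input =
  num_A :: nat
  num_B :: nat
  edges :: "(nat \<times> nat) set"
  arrival_order :: "nat list"

definition mbm_instance :: "mbm_input \<Rightarrow> bool" where
  "mbm_instance I \<longleftrightarrow>
     edges I \<subseteq> {1..num_A I} \<times> {1..num_B I} \<and>
     distinct (arrival_order I) \<and> set (arrival_order I) = {1..num_A I}"

type_synonym arrival = "nat \<times> nat set"

definition arrivals :: "mbm_input \<Rightarrow> arrival list" where
  "arrivals I = map (\<lambda>a. (a, edges I `` {a})) (arrival_order I)"

text \<open>Edges are ordered pairs, so the two sides need not be disjoint as sets of numbers.\<close>

definition matching :: "(nat \<times> nat) set \<Rightarrow> (nat \<times> nat) set \<Rightarrow> bool" where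
  "matching E M \<longleftrightarrow> M \<subseteq> E \<and> inj_on fst M \<and> inj_on snd M"

definition maximum_matching :: "(nat \<times> nat) set \<Rightarrow> (nat \<times> nat) set \<Rightarrow> bool" where
  "maximum_matching E M \<longleftrightarrow> matching E M \<and> (\<forall>M'. matching E M' \<longrightarrow> card M' \<le> card M)"

text \<open>
  A deterministic online rule sees the earlier arrivals, the matching built so far and the
  current arrival, and answers with the partner of the arriving vertex, if any.  An algorithm
  with advice additionally knows the size of the offline side and the advice string from the
  start.  A rule may return an illegal partner; in that case the result of the run is
  not a matching of the graph, which is ruled out by the definition of competitiveness.
\<close>

type_synonym online_rule = "arrival list \<Rightarrow> (nat \<times> nat) set \<Rightarrow> arrival \<Rightarrow> nat option"
type_synonym advice_algorithm = "nat \<Rightarrow> bool list \<Rightarrow> online_rule"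
type_synonym advice_oracle = "mbm_input \<Rightarrow> bool list"

fun run_from :: "online_rule \<Rightarrow> arrival list \<Rightarrow> (nat \<times> nat) set \<Rightarrow> arrival list \<Rightarrow> (nat \<times> nat) set" where
  "run_from d past M [] = M"
| "run_from d past M (r # rs) =
     run_from d (past @ [r])
       (case d past M r of None \<Rightarrow> M | Some b \<Rightarrow> insert (fst r, b) M) rs"

definition run :: "online_rule \<Rightarrow> mbm_input \<Rightarrow> (nat \<times> nat) set" where
  "run d I = run_from d [] {} (arrivals I)"

definition run_with_advice :: "advice_algorithm \<Rightarrow> advice_oracle \<Rightarrow> mbm_input \<Rightarrow> (nat \<times> nat) set" where
  "run_with_advice alg orc I = run (alg (num_B I) (orc I)) I"

definition competitive_with_advice :: "real \<Rightarrow> advice_algorithm \<Rightarrow> advice_oracle \<Rightarrow> bool" where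
  "competitive_with_advice \<rho> alg orc \<longleftrightarrow>
     (\<forall>I. mbm_instance I \<longrightarrow>
        matching (edges I) (run_with_advice alg orc I) \<and>
        (\<forall>M_opt. maximum_matching (edges I) M_opt \<longrightarrow>
           real (card (run_with_advice alg orc I)) \<ge> \<rho> * real (card M_opt)))"

definition uses_advice_bits :: "advice_oracle \<Rightarrow> (mbm_input \<Rightarrow> nat) \<Rightarrow> bool" where
  "uses_advice_bits orc k \<longleftrightarrow> (\<forall>I. mbm_instance I \<longrightarrow> length (orc I) = k I)"

definition ranking :: "(nat \<Rightarrow> nat) \<Rightarrow> online_rule" where
  "ranking \<sigma> past M r =
     (let F = {b \<in> snd r. b \<notin> snd ` M} in
      if F = {} then None else Some (arg_min_on \<sigma> F))"

text \<open>The permutation $\sigma_c$ of \<open>{1..m}\<close>, extended by the identity outside.\<close>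

definition category_ranking :: "nat \<Rightarrow> (nat \<Rightarrow> nat) \<Rightarrow> (nat \<Rightarrow> nat)" where
  "category_ranking m c =
     (THE \<sigma>. \<sigma> permutes {1..m} \<and>
        (\<forall>b1 \<in> {1..m}. \<forall>b2 \<in> {1..m}.
           \<sigma> b1 < \<sigma> b2 \<longleftrightarrow> c b1 < c b2 \<or> (c b1 = c b2 \<and> b1 < b2)))"

lemma category_ranking_unique_exists:
  fixes c :: "nat \<Rightarrow> nat"
  shows "\<exists>!\<sigma>. \<sigma> permutes {1..m} \<and>
        (\<forall>b1 \<in> {1..m}. \<forall>b2 \<in> {1..m}.
           \<sigma> b1 < \<sigma> b2 \<longleftrightarrow> c b1 < c b2 \<or> (c b1 = c b2 \<and> b1 < b2))"
    (is "\<exists>!\<sigma>. ?P \<sigma>")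
proof (rule ex_ex1I)
  define L where "L b1 b2 \<longleftrightarrow> c b1 < c b2 \<or> (c b1 = c b2 \<and> b1 < b2)" for b1 b2
  define S where "S b = {b' \<in> {1..m}. \<not> L b b'}" for b
  define f where "f b = card (S b)" for b
  have fin: "finite (S b)" for b by (simp add: S_def)
  have less: "f b1 < f b2" if "L b1 b2" "b1 \<in> {1..m}" "b2 \<in> {1..m}" for b1 b2
    unfolding f_def
  proof (rule psubset_card_mono[OF fin])
    have "b2 \<in> S b2" "b2 \<notin> S b1" "S b1 \<subseteq> S b2"
      using that by (auto simp: S_def L_def)
    then show "S b1 \<subset> S b2" by auto
  qed
  have tot: "L b1 b2 \<or> L b2 b1 \<or> b1 = b2" for b1 b2 by (auto simp: L_def)
  have iff: "f b1 < f b2 \<longleftrightarrow> L b1 b2" if "b1 \<in> {1..m}" "b2 \<in> {1..m}" for b1 b2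
    using less[of b1 b2] less[of b2 b1] tot[of b1 b2] that by auto
  have inj: "inj_on f {1..m}"
    by (rule inj_onI) (metis iff less_irrefl tot)
  have sub: "f ` {1..m} \<subseteq> {1..m}"
  proof
    fix y assume "y \<in> f ` {1..m}"
    then obtain b where b: "b \<in> {1..m}" "y = card (S b)" by (auto simp: f_def)
    have "b \<in> S b" using b by (auto simp: S_def L_def)
    then have "card (S b) > 0" using fin card_gt_0_iff by blast
    moreover have "card (S b) \<le> card {1..m}" by (rule card_mono) (auto simp: S_def)
    ultimately show "y \<in> {1..m}" using b by auto
  qed
  have "bij_betw f {1..m} {1..m}"
    unfolding bij_betw_def using inj sub endo_inj_surj by blast
  then have "bij_betw (\<lambda>b. if b \<in> {1..m} then f b else b) {1..m} {1..m}"
    by (rule bij_betw_cong[THEN iffD1, rotated]) simp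
  then have "(\<lambda>b. if b \<in> {1..m} then f b else b) permutes {1..m}"
    by (rule bij_imp_permutes) auto
  then have "?P (\<lambda>b. if b \<in> {1..m} then f b else b)"
    using iff by (simp add: L_def)
  then show "\<exists>\<sigma>. ?P \<sigma>" by blast
next
  have pos: "\<sigma> b = card {b' \<in> {1..m}. \<not> \<sigma> b < \<sigma> b'}"
    if "\<sigma> permutes {1..m}" "b \<in> {1..m}" for \<sigma> :: "nat \<Rightarrow> nat" and b
  proof -
    have im: "\<sigma> ` {1..m} = {1..m}" using that permutes_image by blast
    have "\<sigma> b \<in> {1..m}" using im that by blast
    then have "\<sigma> ` {b' \<in> {1..m}. \<not> \<sigma> b < \<sigma> b'} = {1..\<sigma> b}"
      using im by (fastforce simp: image_iff set_eq_iff)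
    moreover have "inj_on \<sigma> {b' \<in> {1..m}. \<not> \<sigma> b < \<sigma> b'}"
      using permutes_inj_on[OF that(1)] .
    ultimately show ?thesis by (metis card_image card_atLeastAtMost diff_Suc_1)
  qed
  fix \<sigma> \<tau> assume P: "?P \<sigma>" "?P \<tau>"
  show "\<sigma> = \<tau>"
  proof
    fix b
    show "\<sigma> b = \<tau> b"
    proof (cases "b \<in> {1..m}")
      case True
      have "{b' \<in> {1..m}. \<not> \<sigma> b < \<sigma> b'} = {b' \<in> {1..m}. \<not> \<tau> b < \<tau> b'}"
        using P True by blast
      then show ?thesis using pos[of \<sigma> b] pos[of \<tau> b] P True by simp
    next
      case False
      then show ?thesis using P by (simp add: permutes_def)
    qed
  qed
qed

text \<open>Bit number \<open>b - 1\<close> of the advice is set iff vertex \<open>b\<close> has category 2.\<close>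

definition encode_categories :: "nat \<Rightarrow> (nat \<Rightarrow> nat) \<Rightarrow> bool list" where
  "encode_categories m c = map (\<lambda>b. c b = 2) [1..<Suc m]"

definition decode_categories :: "bool list \<Rightarrow> nat \<Rightarrow> nat" where
  "decode_categories bs b = (if bs ! (b - 1) then 2 else 1)"

lemma decode_encode_categories:
  assumes "b \<in> {1..m}" "c b \<in> {1, 2}"
  shows "decode_categories (encode_categories m c) b = c b"
  using assms by (auto simp: decode_categories_def encode_categories_def nth_append simp del: upt_Suc)

definition greedy_category :: "mbm_input \<Rightarrow> nat \<Rightarrow> nat" where
  "greedy_category I b = (if b \<notin> snd ` run (ranking id) I then 1 else 2)"

definition category_oracle :: advice_oracle where
  "category_oracle I = encode_categories (num_B I) (greedy_category I)"

definition category_algorithm :: advice_algorithm where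
  "category_algorithm m bs = ranking (category_ranking m (decode_categories bs))"

lemma run_category_algorithm:
  "run_with_advice category_algorithm category_oracle I =
     run (ranking (category_ranking (num_B I) (greedy_category I))) I"
proof -
  have "decode_categories (category_oracle I) b = greedy_category I b" if "b \<in> {1..num_B I}" for b
    unfolding category_oracle_def
    by (rule decode_encode_categories[OF that]) (simp add: greedy_category_def)
  then have "category_ranking (num_B I) (decode_categories (category_oracle I)) =
      category_ranking (num_B I) (greedy_category I)"
    unfolding category_ranking_def by (intro arg_cong[where f = The] ext conj_cong ball_cong refl) simp
  then show ?thesis by (simp add: run_with_advice_def category_algorithm_def)
qed

end

theory Submission imports Defs begin

text \<open>
  Let \<open>M\<^sub>G\<close> be the oracle's matching and \<open>M\<close> the output, and let \<open>s\<close> and \<open>t\<close> be the numbers of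
  edges of \<open>M\<close> into category 1 and category 2.  Category 1 is preferred, so \<open>M\<close> restricted to it is a
  maximal matching there and a maximum matching has at most \<open>2 s\<close> edges into category 1.  At
  every moment the category-2 vertices taken by the second run are also taken by the first run;
  hence each \<open>A\<close>-vertex matched by \<open>M\<^sub>G\<close> is matched by \<open>M\<close>, so category 2 has at most \<open>s + t\<close>
  vertices.  Together, \<open>|M\<^sup>*| \<le> 3 s + t\<close>.  An \<open>A\<close>-vertex that \<open>M\<close> leaves unmatched is
  unmatched in \<open>M\<^sub>G\<close> too, so all its neighbours lie in category 2 and are matched by \<open>M\<close>;
  therefore \<open>|M\<^sup>*| \<le> (s + t) + t\<close>.  Adding the first bound to twice the second gives
  \<open>3 |M\<^sup>*| \<le> 5 (s + t)\<close>.
\<close>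

section \<open>Ranking runs on lists of arrivals\<close>

lemma run_from_append:
  "run_from d past M (xs @ ys) = run_from d (past @ xs) (run_from d past M xs) ys"
  by (induction xs arbitrary: past M) auto

text \<open>The invariants below speak of the matching after a prefix of the arrivals, so the
  inductions append arrivals at the end, whereas \<open>run_from\<close> consumes them from the
  front.\<close>

lemma run_from_snoc:
  "run_from d past M (xs @ [r]) =
     (case d (past @ xs) (run_from d past M xs) r of
        None \<Rightarrow> run_from d past M xs
      | Some b \<Rightarrow> insert (fst r, b) (run_from d past M xs))"
  by (simp add: run_from_append)

lemma ranking_None_iff: "ranking \<sigma> past M r = None \<longleftrightarrow> snd r \<subseteq> snd ` M"
  by (auto simp: ranking_def Let_def)

lemma ranking_SomeD:
  assumes "ranking \<sigma> past M r = Some b" "finite (snd r)"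
  shows "b \<in> snd r" "b \<notin> snd ` M"
    and "\<And>b'. b' \<in> snd r \<Longrightarrow> b' \<notin> snd ` M \<Longrightarrow> \<sigma> b \<le> \<sigma> b'"
proof -
  define F where "F = {b \<in> snd r. b \<notin> snd ` M}"
  have F: "F \<noteq> {}" "finite F" "b = arg_min_on \<sigma> F"
    using assms by (auto simp: ranking_def Let_def F_def split: if_splits)
  have "b \<in> F" using arg_min_if_finite(1)[OF F(2,1), of \<sigma>] F(3) by simp
  then show "b \<in> snd r" "b \<notin> snd ` M" by (auto simp: F_def)
  show "\<sigma> b \<le> \<sigma> b'" if "b' \<in> snd r" "b' \<notin> snd ` M" for b'
    using arg_min_least[OF F(2,1), of b' \<sigma>] F(3) that by (simp add: F_def)
qed

lemma run_from_ranking_matching: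
  assumes "distinct (map fst xs)" "\<forall>r\<in>set xs. finite (snd r)"
  shows "matching {(a, b). \<exists>N. (a, N) \<in> set xs \<and> b \<in> N} (run_from (ranking \<sigma>) past {} xs)"
  using assms
proof (induction xs rule: rev_induct)
  case Nil
  then show ?case by (simp add: matching_def)
next
  case (snoc r xs)
  let ?M = "run_from (ranking \<sigma>) past {} xs"
  have IH: "matching {(a, b). \<exists>N. (a, N) \<in> set xs \<and> b \<in> N} ?M" using snoc by auto
  have new: "fst r \<notin> fst ` set xs" using snoc.prems by auto
  show ?case
  proof (cases "ranking \<sigma> (past @ xs) ?M r")
    case None
    then show ?thesis using IH by (fastforce simp: run_from_snoc matching_def)
  next
    case (Some b)
    have b: "b \<in> snd r" "b \<notin> snd ` ?M" using ranking_SomeD[OF Some] snoc.prems by auto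
    have "fst ` ?M \<subseteq> fst ` set xs"
    proof
      fix a assume "a \<in> fst ` ?M"
      then obtain N where "(a, N) \<in> set xs" using IH by (auto simp: matching_def)
      then show "a \<in> fst ` set xs" by force
    qed
    then have "fst r \<notin> fst ` ?M" using new by blast
    then have "inj_on fst (insert (fst r, b) ?M)" "inj_on snd (insert (fst r, b) ?M)"
      using IH b by (auto simp: matching_def)
    moreover have "insert (fst r, b) ?M \<subseteq> {(a, b). \<exists>N. (a, N) \<in> set (xs @ [r]) \<and> b \<in> N}"
      using IH b by (cases r) (auto simp: matching_def)
    ultimately show ?thesis using Some by (simp add: run_from_snoc matching_def)
  qed
qed

text \<open>Edges are never removed, so a vertex \<open>b\<close> free at the end was already free
  when \<open>a\<close> arrived. Hence \<open>a\<close> was not left alone, and the partner chosen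
  for it had minimum rank among candidates including \<open>b\<close>. This yields both maximality
  of every ranking run and the preference for category 1.\<close>

lemma run_from_ranking_stable:
  assumes "\<forall>r\<in>set xs. finite (snd r)" "(a, N) \<in> set xs" "b \<in> N"
    and "b \<notin> snd ` run_from (ranking \<sigma>) past {} xs"
  shows "\<exists>b'. (a, b') \<in> run_from (ranking \<sigma>) past {} xs \<and> \<sigma> b' \<le> \<sigma> b"
  using assms
proof (induction xs rule: rev_induct)
  case Nil
  then show ?case by simp
next
  case (snoc r xs)
  let ?M = "run_from (ranking \<sigma>) past {} xs"
  have free: "b \<notin> snd ` ?M" using snoc.prems(4) by (auto simp: run_from_snoc split: option.splits)
  show ?case
  proof (cases "(a, N) \<in> set xs")
    case True
    then show ?thesis using snoc free by (fastforce simp: run_from_snoc split: option.splits)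
  next
    case False
    then have r: "r = (a, N)" using snoc.prems by auto
    then obtain b' where b': "ranking \<sigma> (past @ xs) ?M r = Some b'"
      using ranking_None_iff[of \<sigma> "past @ xs" ?M r] free snoc.prems(3) by auto
    then have "\<sigma> b' \<le> \<sigma> b" using ranking_SomeD(3)[OF b'] snoc.prems free r by auto
    then show ?thesis using b' r by (auto simp: run_from_snoc)
  qed
qed

text \<open>Meant for \<open>B2\<close> the vertices of category 2, where both rankings order alike.
  The first inclusion, kept as an invariant over prefixes, drives the second: whatever the
  \<sigma>-run takes is still available to the \<tau>-run.\<close>

lemma run_from_ranking_dominated:
  fixes \<sigma> \<tau> :: "nat \<Rightarrow> nat"
  assumes "\<forall>r\<in>set xs. finite (snd r)" "inj_on \<sigma> B2"
    and "\<And>b b'. b \<in> B2 \<Longrightarrow> b' \<in> B2 \<Longrightarrow> \<tau> b \<le> \<tau> b' \<Longrightarrow> \<sigma> b \<le> \<sigma> b'"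
    and "snd ` run_from (ranking \<sigma>) past {} xs \<subseteq> B2"
  shows "snd ` run_from (ranking \<tau>) past {} xs \<inter> B2 \<subseteq> snd ` run_from (ranking \<sigma>) past {} xs \<and>
         fst ` run_from (ranking \<sigma>) past {} xs \<subseteq> fst ` run_from (ranking \<tau>) past {} xs"
  using assms(1,4)
proof (induction xs rule: rev_induct)
  case Nil
  then show ?case by simp
next
  case (snoc r xs)
  let ?S = "run_from (ranking \<sigma>) past {} xs" and ?T = "run_from (ranking \<tau>) past {} xs"
  let ?s = "ranking \<sigma> (past @ xs) ?S r" and ?t = "ranking \<tau> (past @ xs) ?T r"
  have fin: "finite (snd r)" using snoc.prems by simp
  have "snd ` ?S \<subseteq> B2" using snoc.prems(2) by (auto simp: run_from_snoc split: option.splits)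
  then have IH: "snd ` ?T \<inter> B2 \<subseteq> snd ` ?S" "fst ` ?S \<subseteq> fst ` ?T"
    using snoc by auto
  have sB2: "b \<in> B2" if "?s = Some b" for b
    using snoc.prems(2) that by (auto simp: run_from_snoc)
  have matched: "?t \<noteq> None" if "?s = Some b" for b
    using ranking_SomeD[OF that fin] sB2[OF that] IH(1)
      ranking_None_iff[of \<tau> "past @ xs" ?T r] by auto
  \<comment> \<open>The only threat to the invariant is a \<open>b\<close> in \<open>B2\<close>
    newly taken by \<tau> and still free for \<sigma>. Then \<sigma> picks some \<open>b'\<close>,
    which by the invariant is free for \<tau> as well. Each rule prefers its own choice, and the
    orders agree on \<open>B2\<close>, so the choices coincide.\<close>
  have ahead: "?s = Some b" if t: "?t = Some b" and b: "b \<in> B2" "b \<notin> snd ` ?S" for b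
  proof -
    note t' = ranking_SomeD[OF t fin]
    obtain b' where s: "?s = Some b'"
      using ranking_None_iff[of \<sigma> "past @ xs" ?S r] t'(1) b by auto
    note s' = ranking_SomeD[OF s fin]
    have "\<sigma> b' \<le> \<sigma> b" using s'(3) t'(1) b by blast
    moreover have "\<tau> b \<le> \<tau> b'" using t'(3) s' sB2[OF s] IH(1) by blast
    then have "\<sigma> b \<le> \<sigma> b'" using assms(3) b sB2[OF s] by blast
    ultimately have "b = b'" using inj_onD[OF assms(2)] b sB2[OF s] by simp
    then show ?thesis using s by simp
  qed
  have "snd ` run_from (ranking \<tau>) past {} (xs @ [r]) \<inter> B2
      \<subseteq> snd ` run_from (ranking \<sigma>) past {} (xs @ [r])"
  proof (cases ?t)
    case None
    then show ?thesis using IH(1) by (auto simp: run_from_snoc split: option.splits)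
  next
    case (Some b)
    have "b \<in> snd ` run_from (ranking \<sigma>) past {} (xs @ [r])" if "b \<in> B2"
      using ahead[OF Some that] by (cases "b \<in> snd ` ?S") (auto simp: run_from_snoc split: option.splits)
    moreover have "?S \<subseteq> run_from (ranking \<sigma>) past {} (xs @ [r])"
      by (auto simp: run_from_snoc split: option.splits)
    ultimately show ?thesis using IH(1) Some by (simp add: run_from_snoc[of "ranking \<tau>"]) blast
  qed
  moreover have "fst ` run_from (ranking \<sigma>) past {} (xs @ [r])
      \<subseteq> fst ` run_from (ranking \<tau>) past {} (xs @ [r])"
    using IH(2) matched by (auto simp: run_from_snoc split: option.splits)
  ultimately show ?case by blast
qed

section \<open>Counting the edges of a competing matching\<close>

lemma card_inj_on_vimage_le:
  assumes "inj_on f M" "finite S"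
  shows "card {e \<in> M. f e \<in> S} \<le> card S"
  by (rule card_inj_on_le[of f]) (use assms in \<open>auto intro: inj_on_subset\<close>)

text \<open>Purely graph-theoretic: the hypotheses collect what the runs provide. Category 2 is the
  \<open>snd\<close> image of \<open>Mg\<close>, and \<open>M1\<close>, \<open>M2\<close> hold the s
  and t edges of the overview.\<close>

lemma matching_three_fifths:
  assumes fin: "finite E" and opt: "matching E Mo" and M: "matching E M" and Mg: "matching E Mg"
    and cat1: "\<And>a b. (a, b) \<in> E \<Longrightarrow> b \<notin> snd ` Mg \<Longrightarrow> b \<notin> snd ` M
                 \<Longrightarrow> \<exists>b'. (a, b') \<in> M \<and> b' \<notin> snd ` Mg"
    and dom: "fst ` Mg \<subseteq> fst ` M"
    and maxMg: "\<And>a b. (a, b) \<in> E \<Longrightarrow> a \<in> fst ` Mg \<or> b \<in> snd ` Mg"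
    and maxM: "\<And>a b. (a, b) \<in> E \<Longrightarrow> a \<in> fst ` M \<or> b \<in> snd ` M"
  shows "3 * card Mo \<le> 5 * card M"
proof -
  define M1 where "M1 = {e \<in> M. snd e \<notin> snd ` Mg}"
  define M2 where "M2 = {e \<in> M. snd e \<in> snd ` Mg}"
  have sub: "Mo \<subseteq> E" "M \<subseteq> E" "Mg \<subseteq> E" using opt M Mg by (auto simp: matching_def)
  have finM: "finite Mo" "finite M" "finite Mg" using sub fin finite_subset by blast+
  have fin12: "finite M1" "finite M2" using finM by (auto simp: M1_def M2_def)
  have inj: "inj_on fst Mo" "inj_on snd Mo" using opt by (auto simp: matching_def)
  have M12: "card M = card M1 + card M2"
    by (subst card_Un_disjoint[symmetric, OF fin12])
      (auto simp: M1_def M2_def intro: arg_cong[where f = card])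
  have inS: "card {e \<in> Mo. snd e \<in> snd ` K} \<le> card K" if "finite K" for K :: "(nat \<times> nat) set"
    using card_inj_on_vimage_le[OF inj(2), of "snd ` K"] card_image_le[OF that, of snd] that
    by simp
  have inF: "card {e \<in> Mo. fst e \<in> fst ` K} \<le> card K" if "finite K" for K :: "(nat \<times> nat) set"
    using card_inj_on_vimage_le[OF inj(1), of "fst ` K"] card_image_le[OF that, of fst] that
    by simp

  \<comment> \<open>An edge into category 1 shares an endpoint with \<open>M1\<close>, by
    \<open>cat1\<close> if its \<open>B\<close>-end is free in \<open>M\<close>. Each edge of
    \<open>M1\<close> is charged at most once per endpoint, which gives the factor 2.\<close>
  have "Mo \<subseteq> {e \<in> Mo. snd e \<in> snd ` Mg} \<union> ({e \<in> Mo. snd e \<in> snd ` M1} \<union> {e \<in> Mo. fst e \<in> fst ` M1})"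
  proof
    fix e assume e: "e \<in> Mo"
    obtain a b where ab: "e = (a, b)" "(a, b) \<in> E" using e sub by (cases e) auto
    have "b \<in> snd ` M1 \<or> a \<in> fst ` M1" if b: "b \<notin> snd ` Mg"
    proof (cases "b \<in> snd ` M")
      case True
      then show ?thesis using b unfolding M1_def by blast
    next
      case False
      then obtain b' where "(a, b') \<in> M1" using cat1[OF ab(2) b] by (auto simp: M1_def)
      then show ?thesis by force
    qed
    then show "e \<in> {e \<in> Mo. snd e \<in> snd ` Mg} \<union>
        ({e \<in> Mo. snd e \<in> snd ` M1} \<union> {e \<in> Mo. fst e \<in> fst ` M1})"
      using e ab by auto
  qed
  then have "card Mo \<le> card ({e \<in> Mo. snd e \<in> snd ` Mg} \<union>
      ({e \<in> Mo. snd e \<in> snd ` M1} \<union> {e \<in> Mo. fst e \<in> fst ` M1}))"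
    by (rule card_mono[rotated]) (use finM in auto)
  also have "\<dots> \<le> card {e \<in> Mo. snd e \<in> snd ` Mg} +
      (card {e \<in> Mo. snd e \<in> snd ` M1} + card {e \<in> Mo. fst e \<in> fst ` M1})"
    by (meson add_left_mono card_Un_le le_trans)
  also have "\<dots> \<le> card Mg + (card M1 + card M1)"
    using inS[OF finM(3)] inS[OF fin12(1)] inF[OF fin12(1)] by linarith
  also have "card Mg \<le> card M"
  proof -
    have "card Mg = card (fst ` Mg)" using Mg by (simp add: matching_def card_image)
    also have "\<dots> \<le> card (fst ` M)" using dom finM by (intro card_mono) auto
    also have "\<dots> \<le> card M" using finM by (intro card_image_le)
    finally show ?thesis .
  qed
  finally have bound1: "card Mo \<le> 3 * card M1 + card M2" using M12 by simp

  \<comment> \<open>If \<open>M\<close> misses the \<open>A\<close>-end, so does \<open>Mg\<close>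
    by \<open>dom\<close>; maximality of \<open>Mg\<close> and of \<open>M\<close> then places the
    \<open>B\<close>-end in category 2 and makes it matched by \<open>M\<close>.\<close>
  have "Mo \<subseteq> {e \<in> Mo. fst e \<in> fst ` M} \<union> {e \<in> Mo. snd e \<in> snd ` M2}"
  proof
    fix e assume e: "e \<in> Mo"
    obtain a b where ab: "e = (a, b)" "(a, b) \<in> E" using e sub by (cases e) auto
    have "b \<in> snd ` M2" if a: "a \<notin> fst ` M"
    proof -
      have "b \<in> snd ` Mg" using maxMg[OF ab(2)] dom a by blast
      moreover obtain e' where "e' \<in> M" "b = snd e'" using maxM[OF ab(2)] a by auto
      ultimately have "e' \<in> M2" by (simp add: M2_def)
      then show ?thesis using \<open>b = snd e'\<close> by blast
    qed
    then show "e \<in> {e \<in> Mo. fst e \<in> fst ` M} \<union> {e \<in> Mo. snd e \<in> snd ` M2}"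
      using e ab by auto
  qed
  then have "card Mo \<le> card ({e \<in> Mo. fst e \<in> fst ` M} \<union> {e \<in> Mo. snd e \<in> snd ` M2})"
    by (rule card_mono[rotated]) (use finM in auto)
  also have "\<dots> \<le> card M + card M2"
    using card_Un_le inF[OF finM(2)] inS[OF fin12(2)] by (meson add_mono le_trans)
  finally have bound2: "card Mo \<le> card M1 + 2 * card M2" using M12 by simp
  show ?thesis using bound1 bound2 M12 by linarith
qed

section \<open>The category order and runs on whole instances\<close>

lemma category_ranking_less_iff:
  assumes "b1 \<in> {1..m}" "b2 \<in> {1..m}"
  shows "category_ranking m c b1 < category_ranking m c b2 \<longleftrightarrow>
           c b1 < c b2 \<or> (c b1 = c b2 \<and> b1 < b2)"
  using theI'[OF category_ranking_unique_exists[of m c]] assms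
  unfolding category_ranking_def by blast

lemma finite_edges: "mbm_instance I \<Longrightarrow> finite (edges I)"
  unfolding mbm_instance_def by (meson finite_SigmaI finite_atLeastAtMost finite_subset)

lemma arrivals_finite:
  assumes "mbm_instance I"
  shows "\<forall>r\<in>set (arrivals I). finite (snd r)"
  using finite_edges[OF assms] by (auto simp: arrivals_def finite_Image)

lemma run_ranking_matching:
  assumes "mbm_instance I"
  shows "matching (edges I) (run (ranking \<sigma>) I)"
proof -
  have "distinct (map fst (arrivals I))"
    using assms by (simp add: mbm_instance_def arrivals_def comp_def)
  moreover have "{(a, b). \<exists>N. (a, N) \<in> set (arrivals I) \<and> b \<in> N} \<subseteq> edges I"
    by (auto simp: arrivals_def)
  ultimately show ?thesis
    using run_from_ranking_matching[OF _ arrivals_finite[OF assms]]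
    unfolding run_def matching_def by blast
qed

lemma run_ranking_stable:
  assumes "mbm_instance I" "(a, b) \<in> edges I" "b \<notin> snd ` run (ranking \<sigma>) I"
  shows "\<exists>b'. (a, b') \<in> run (ranking \<sigma>) I \<and> \<sigma> b' \<le> \<sigma> b"
proof -
  have "(a, edges I `` {a}) \<in> set (arrivals I)"
    using assms(1,2) by (auto simp: mbm_instance_def arrivals_def)
  then show ?thesis
    using run_from_ranking_stable[OF arrivals_finite[OF assms(1)]] assms(2,3)
    unfolding run_def by blast
qed

lemma category_run_three_fifths:
  assumes I: "mbm_instance I" and opt: "matching (edges I) Mo"
  shows "3 * card Mo \<le> 5 * card (run (ranking (category_ranking (num_B I) (greedy_category I))) I)"
proof -
  define \<tau> where "\<tau> = category_ranking (num_B I) (greedy_category I)"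
  let ?Mg = "run (ranking id) I" and ?M = "run (ranking \<tau>) I"
  have range: "b \<in> {1..num_B I}" if "(a, b) \<in> edges I" for a b
    using I that by (auto simp: mbm_instance_def)
  have sub: "?Mg \<subseteq> edges I" "?M \<subseteq> edges I"
    using run_ranking_matching[OF I] by (auto simp: matching_def)
  have B2: "b \<in> {1..num_B I}" if "b \<in> snd ` ?Mg" for b using sub range that by auto
  \<comment> \<open>Both vertices have category 2, so \<tau> breaks the tie by index, exactly as the
    identity ranking does.\<close>
  have "id b \<le> id b'" if "b \<in> snd ` ?Mg" "b' \<in> snd ` ?Mg" "\<tau> b \<le> \<tau> b'" for b b'
    using category_ranking_less_iff[OF B2[OF that(2)] B2[OF that(1)], of "greedy_category I"] that
    by (auto simp: \<tau>_def greedy_category_def)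
  then have dom: "fst ` ?Mg \<subseteq> fst ` ?M"
    using run_from_ranking_dominated[of "arrivals I" id "snd ` ?Mg" \<tau> "[]"] arrivals_finite[OF I]
    by (simp add: run_def)
  have cat1: "\<exists>b'. (a, b') \<in> ?M \<and> b' \<notin> snd ` ?Mg"
    if e: "(a, b) \<in> edges I" and b: "b \<notin> snd ` ?Mg" "b \<notin> snd ` ?M" for a b
  proof -
    obtain b' where b': "(a, b') \<in> ?M" "\<tau> b' \<le> \<tau> b" using run_ranking_stable[OF I e b(2)] by blast
    have "b' \<in> {1..num_B I}" using b'(1) sub range by blast
    \<comment> \<open>A vertex of larger category would be ranked strictly behind \<open>b\<close>.
      As \<open>b\<close> has category 1, so does its rival \<open>b'\<close>.\<close>
    then have "\<not> greedy_category I b < greedy_category I b'"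
      using category_ranking_less_iff[OF range[OF e], of b' "greedy_category I"] b'(2)
      by (simp add: \<tau>_def)
    then have "b' \<notin> snd ` ?Mg" using b(1) by (simp add: greedy_category_def split: if_splits)
    then show ?thesis using b' by blast
  qed
  \<comment> \<open>Stated for arbitrary \<sigma> because it serves both runs, the oracle's and the
    algorithm's.\<close>
  have maximal: "a \<in> fst ` run (ranking \<sigma>) I \<or> b \<in> snd ` run (ranking \<sigma>) I"
    if "(a, b) \<in> edges I" for a b \<sigma>
    using run_ranking_stable[OF I that] by force
  show ?thesis
    using matching_three_fifths[OF finite_edges[OF I] opt run_ranking_matching[OF I]
        run_ranking_matching[OF I] cat1 dom maximal maximal]
    by (simp add: \<tau>_def)
qed

theorem theorem19:
  "competitive_with_advice (3/5) category_algorithm category_oracle \<and>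
   uses_advice_bits category_oracle num_B"
proof
  show "competitive_with_advice (3/5) category_algorithm category_oracle"
    unfolding competitive_with_advice_def run_category_algorithm
  proof (intro allI impI conjI)
    fix I Mo
    assume I: "mbm_instance I"
    show "matching (edges I) (run (ranking (category_ranking (num_B I) (greedy_category I))) I)"
      by (rule run_ranking_matching[OF I])
    assume "maximum_matching (edges I) Mo"
    then have "3 * card Mo \<le>
        5 * card (run (ranking (category_ranking (num_B I) (greedy_category I))) I)"
      using category_run_three_fifths[OF I] by (simp add: maximum_matching_def)
    then show "3/5 * real (card Mo) \<le>
        real (card (run (ranking (category_ranking (num_B I) (greedy_category I))) I))"
      by linarith
  qed
  show "uses_advice_bits category_oracle num_B"
    by (simp add: uses_advice_bits_def category_oracle_def encode_categories_def del: upt_Suc)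
qed

end
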